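(* For real $\kappa>1$, $x>1$ and $a\ge1$ let \[ F^{[\kappa]}(x,a):=\frac{1}{\kappa\log x}\log\left(\frac{(x^{a+1}-1)^{\kappa}-(x^{a}-1)^{\kappa}}{(x^{a+1}-x)^{\kappa}-(x^{a}-x)^{\kappa}}\right). \] Then $F^{[\kappa]}(x,a)$ is continuous and strictly decreasing in $x$ and in $a$, and continuous and strictly increasing in $\kappa$. Moreover, for $a\ge1$ and $x>1$ respectively, \[ \lim_{x\to\infty}F^{[\kappa]}(x,a)=0,\qquad \lim_{a\to\infty}F^{[\kappa]}(x,a)=0,\qquad \lim_{x\to1^{+}}F^{[\kappa]}(x,a)=\infty, \] and \[ \lim_{\kappa\to\infty}F^{[\kappa]}(x,a)=\frac{1}{\log x}\log\left(\frac{x^{a+1}-1}{x^{a+1}-x}\right),\qquad \lim_{\kappa\to1^{+}}F^{[\kappa]}(x,a)=0. \] *)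

theory Defs
  imports Complex_Main
begin

text \<open>The case \<open>a = 1\<close> makes the subtracted base \<open>x powr a - x\<close> vanish; since
  \<open>0 powr \<kappa> = 0\<close>, this agrees with the convention \<open>0\<^sup>\<kappa> = 0\<close> for \<open>\<kappa> > 0\<close>.\<close>

definition F :: "real \<Rightarrow> real \<Rightarrow> real \<Rightarrow> real" where
  "F \<kappa> x a =
     1 / (\<kappa> * ln x) *
     ln (((x powr (a + 1) - 1) powr \<kappa> - (x powr a - 1) powr \<kappa>) /
         ((x powr (a + 1) - x) powr \<kappa> - (x powr a - x) powr \<kappa>))"

end

theory Submission
  imports Defs
begin

text \<open>
  Write \<open>F = ln r / (\<kappa> ln x)\<close>. Numerator and denominator of \<open>r\<close> are differences of
  \<open>\<kappa>\<close>-th powers, so quotients of such differences can be compared through their derivatives.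
  After rescaling by \<open>x powr (a \<kappa>)\<close>, Cauchy's mean value theorem in each difference shows that
  \<open>r\<close> decreases in \<open>a\<close>; the same theorem gives \<open>r > 1\<close>.
  For the dependence on \<open>x\<close> one reads \<open>r\<close> as the average over \<open>t \<in> [a, a + 1]\<close> of
  \<open>((x powr t - 1) / (x powr t - x)) powr (\<kappa> - 1)\<close> with weight proportional to
  \<open>(x powr t - x) powr (\<kappa> - 1) * x powr t\<close>: the averaged function decreases in \<open>x\<close> and in \<open>t\<close>,
  while the weight moves to the right as \<open>x\<close> grows, so \<open>r\<close> decreases in \<open>x\<close>. Since \<open>r > 1\<close> is
  decreasing, the limits \<open>x \<rightarrow> 1\<close> and \<open>x \<rightarrow> \<infinity>\<close> are those of \<open>1 / ln x\<close>.
  For the dependence on \<open>\<kappa>\<close>, factoring out the larger powers leaves the term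
  \<open>- ln ((1 - s powr \<kappa>) / (1 - q powr \<kappa>)) / \<kappa>\<close> with \<open>s < q < 1\<close>, and the quotient under the
  logarithm decreases because the slopes of a convex power function increase.
\<close>

section \<open>Slopes and mean values of power functions\<close>

lemma powr_chord_less:
  fixes a b c r :: real
  assumes "1 < r" "0 \<le> a" "a < b" "b < c"
  shows "(b powr r - a powr r) * (c - b) < (c powr r - b powr r) * (b - a)"
proof -
  have mvt: "\<exists>\<xi>. u < \<xi> \<and> \<xi> < v \<and> v powr r - u powr r = (v - u) * (r * \<xi> powr (r - 1))"
    if "0 \<le> u" "u < v" for u v :: real
  proof -
    have "\<exists>l \<xi>. u < \<xi> \<and> \<xi> < v \<and> DERIV (\<lambda>t. t powr r) \<xi> :> l \<and>
        v powr r - u powr r = (v - u) * l"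
    proof (rule MVT[OF that(2)])
      show "continuous_on {u..v} (\<lambda>t. t powr r)"
        using assms that by (intro continuous_intros continuous_on_powr') auto
      show "(\<lambda>t. t powr r) differentiable (at t)" if "u < t" "t < v" for t
        using \<open>0 \<le> u\<close> that has_real_derivative_powr[of t r]
        by (auto simp: real_differentiable_def)
    qed
    then obtain l \<xi> where \<xi>: "u < \<xi>" "\<xi> < v" "DERIV (\<lambda>t. t powr r) \<xi> :> l"
      "v powr r - u powr r = (v - u) * l" by blast
    have "l = r * \<xi> powr (r - 1)"
      using DERIV_unique[OF \<xi>(3) has_real_derivative_powr[of \<xi> r]] \<xi> that by simp
    with \<xi> show ?thesis by blast
  qed
  obtain \<xi> where \<xi>: "a < \<xi>" "\<xi> < b" "b powr r - a powr r = (b - a) * (r * \<xi> powr (r - 1))"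
    using mvt[of a b] assms by blast
  obtain \<eta> where \<eta>: "b < \<eta>" "\<eta> < c" "c powr r - b powr r = (c - b) * (r * \<eta> powr (r - 1))"
    using mvt[of b c] assms by auto
  \<comment> \<open>The mean value points of the two adjacent chords are separated by
    \<open>b\<close>, and the derivative of the power function is strictly increasing since
    \<open>r > 1\<close>.\<close>
  have "\<xi> powr (r - 1) < \<eta> powr (r - 1)"
    using assms \<xi> \<eta> by (intro powr_less_mono2) auto
  then have "(b - a) * (c - b) * (r * \<xi> powr (r - 1)) < (b - a) * (c - b) * (r * \<eta> powr (r - 1))"
    using assms by (intro mult_strict_left_mono) auto
  then show ?thesis unfolding \<xi>(3) \<eta>(3) by (simp add: ac_simps)
qed

lemma powr_slope_at_1_less_above:
  fixes y z r :: real
  assumes "1 < r" "1 < y" "y < z"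
  shows "(y powr r - 1) * (z - 1) < (z powr r - 1) * (y - 1)"
  using powr_chord_less[of r 1 y z] assms by (simp add: algebra_simps)

lemma powr_slope_at_1_less_below:
  fixes y z r :: real
  assumes "1 < r" "0 \<le> y" "y < z" "z < 1"
  shows "(1 - y powr r) * (1 - z) < (1 - z powr r) * (1 - y)"
  using powr_chord_less[of r y z 1] assms by (simp add: algebra_simps)

text \<open>Cauchy's mean value theorem for the two shifted powers on \<open>[p, q]\<close>,
  cross-multiplied and with the common factor \<kappa> cancelled. A shift may equal
  \<open>p\<close>; this covers \<open>a = 1\<close>, where \<open>x powr a = x\<close>.\<close>

lemma powr_shift_Cauchy_mvt:
  fixes \<kappa> p q u v :: real
  assumes "0 < \<kappa>" "p < q" "u \<le> p" "v \<le> p"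
  shows "\<exists>\<xi>. p < \<xi> \<and> \<xi> < q \<and>
    ((q - u) powr \<kappa> - (p - u) powr \<kappa>) * (\<xi> - v) powr (\<kappa> - 1) =
    ((q - v) powr \<kappa> - (p - v) powr \<kappa>) * (\<xi> - u) powr (\<kappa> - 1)"
proof -
  \<comment> \<open>The combination is chosen to take equal values at \<open>p\<close> and
    \<open>q\<close>, so its derivative vanishes somewhere in between.\<close>
  define H where "H t = ((q - u) powr \<kappa> - (p - u) powr \<kappa>) * (t - v) powr \<kappa> -
    ((q - v) powr \<kappa> - (p - v) powr \<kappa>) * (t - u) powr \<kappa>" for t
  define H' where "H' t = ((q - u) powr \<kappa> - (p - u) powr \<kappa>) * (\<kappa> * (t - v) powr (\<kappa> - 1)) -
    ((q - v) powr \<kappa> - (p - v) powr \<kappa>) * (\<kappa> * (t - u) powr (\<kappa> - 1))" for t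
  have powr_der: "((\<lambda>t. (t - w) powr \<kappa>) has_real_derivative \<kappa> * (t - w) powr (\<kappa> - 1)) (at t)"
    if "w < t" for w t
    using that by (auto intro!: derivative_eq_intros)
  have der: "(H has_real_derivative H' t) (at t)" if "p < t" for t
    unfolding H_def H'_def by (intro DERIV_diff DERIV_cmult powr_der) (use that assms in auto)
  have "\<exists>l \<xi>. p < \<xi> \<and> \<xi> < q \<and> DERIV H \<xi> :> l \<and> H q - H p = (q - p) * l"
  proof (rule MVT[OF assms(2)])
    have "continuous_on {p..q} (\<lambda>t. (t - w) powr \<kappa>)" if "w \<le> p" for w
      using assms(1) that by (intro continuous_on_powr' continuous_intros) auto
    then show "continuous_on {p..q} H"
      unfolding H_def using assms(3,4) by (intro continuous_on_diff continuous_on_mult_left)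
    show "H differentiable (at t)" if "p < t" for t
      using der[OF that] by (auto simp: real_differentiable_def)
  qed
  then obtain \<xi> l where \<xi>: "p < \<xi>" "\<xi> < q" "DERIV H \<xi> :> l" "H q - H p = (q - p) * l"
    by blast
  have "H q - H p = 0" unfolding H_def by algebra
  then have "l = 0" using \<xi>(4) assms(2) by simp
  then have "H' \<xi> = 0" using DERIV_unique[OF \<xi>(3) der[OF \<xi>(1)]] by simp
  then have "\<kappa> * (((q - u) powr \<kappa> - (p - u) powr \<kappa>) * (\<xi> - v) powr (\<kappa> - 1) -
    ((q - v) powr \<kappa> - (p - v) powr \<kappa>) * (\<xi> - u) powr (\<kappa> - 1)) = 0"
    unfolding H'_def by (simp add: algebra_simps)
  then show ?thesis using \<xi>(1,2) assms(1) by (intro exI[of _ \<xi>]) simp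
qed

lemma powr_diff_pos: "0 < t powr \<kappa> - s powr \<kappa>" if "0 < \<kappa>" "0 \<le> s" "s < t" for s t \<kappa> :: real
  using powr_less_mono2[of \<kappa> s t] that by simp

text \<open>Chebyshev's inequality for averages, stated with antiderivatives so that no integration theory
  is needed: \<open>Ai = \<integral> fi wi\<close> and \<open>Bi = \<integral> wi\<close>, where \<open>w2 / w1\<close> is increasing.\<close>

lemma quotient_less_if_deriv_quotients:
  fixes A1 A2 B1 B2 f1 f2 w1 w2 :: "real \<Rightarrow> real"
  assumes ab: "a < b"
    and cont: "continuous_on {a..b} A1" "continuous_on {a..b} A2"
      "continuous_on {a..b} B1" "continuous_on {a..b} B2"
    and zero: "A1 a = 0" "A2 a = 0" "B1 a = 0" "B2 a = 0"
    and der: "\<And>t. a < t \<Longrightarrow> t < b \<Longrightarrow> (A1 has_real_derivative f1 t * w1 t) (at t)"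
      "\<And>t. a < t \<Longrightarrow> t < b \<Longrightarrow> (A2 has_real_derivative f2 t * w2 t) (at t)"
      "\<And>t. a < t \<Longrightarrow> t < b \<Longrightarrow> (B1 has_real_derivative w1 t) (at t)"
      "\<And>t. a < t \<Longrightarrow> t < b \<Longrightarrow> (B2 has_real_derivative w2 t) (at t)"
    and w_pos: "\<And>t. a < t \<Longrightarrow> t < b \<Longrightarrow> 0 < w1 t" "\<And>t. a < t \<Longrightarrow> t < b \<Longrightarrow> 0 < w2 t"
    and f_less: "\<And>t. a < t \<Longrightarrow> t < b \<Longrightarrow> f2 t < f1 t"
    and f1_anti: "\<And>s t. a < s \<Longrightarrow> s < t \<Longrightarrow> t < b \<Longrightarrow> f1 t \<le> f1 s"
    and w_mono: "\<And>s t. a < s \<Longrightarrow> s < t \<Longrightarrow> t < b \<Longrightarrow> w2 s * w1 t \<le> w1 s * w2 t"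
  shows "A2 b * B1 b < A1 b * B2 b"
proof -
  define H where "H t = A2 t * B1 t - A1 t * B2 t" for t
  have H_neg: "f2 t * w2 t * B1 t + A2 t * w1 t - (f1 t * w1 t * B2 t + A1 t * w2 t) < 0"
    if t: "a < t" "t < b" for t
  proof -
    \<comment> \<open>For frozen \<open>t\<close>, \<open>K t\<close> is exactly the derivative of
      \<open>H\<close> at \<open>t\<close>, while \<open>K a = 0\<close>. So it suffices that
      \<open>K\<close> decreases on \<open>[a, t]\<close>, which turns the claim into a pointwise
      comparison at pairs \<open>s < t\<close>.\<close>
    define K where "K s = (A2 s - f1 t * B2 s) * w1 t - (A1 s - f2 t * B1 s) * w2 t" for s
    have "K t < K a"
    proof (rule DERIV_neg_imp_decreasing_open[OF t(1)])
      show "continuous_on {a..t} K"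
        unfolding K_def
        using t by (intro continuous_intros continuous_on_subset[OF cont(1)]
          continuous_on_subset[OF cont(2)] continuous_on_subset[OF cont(3)]
          continuous_on_subset[OF cont(4)]) auto
      fix s assume s: "a < s" "s < t"
      let ?l = "(f2 s - f1 t) * (w2 s * w1 t) - (f1 s - f2 t) * (w1 s * w2 t)"
      have "(K has_real_derivative ?l) (at s)"
        unfolding K_def
        by (rule derivative_eq_intros der[OF s(1) less_trans[OF s(2) t(2)]] refl)+
          (simp add: algebra_simps)
      moreover have "?l < 0"
      proof -
        have pos: "0 < w1 s * w2 t" "0 < w2 s * w1 t" using w_pos s t by auto
        have f: "f2 s < f1 s" "f2 t < f1 t" "f1 t \<le> f1 s" using f_less f1_anti s t by auto
        show ?thesis
        \<comment> \<open>The subtracted term is positive, because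
          \<open>f2 t < f1 t \<le> f1 s\<close>. Only a positive \<open>f2 s - f1 t\<close> could
          spoil the sign; then \<open>w_mono\<close> bounds its weight by
          \<open>w1 s * w2 t\<close>, and the two coefficients are compared with this common
          weight.\<close>
        proof (cases "f2 s \<le> f1 t")
          case True
          have "(f2 s - f1 t) * (w2 s * w1 t) \<le> 0"
            using True by (intro mult_nonpos_nonneg less_imp_le[OF pos(2)]) simp
          moreover have "0 < (f1 s - f2 t) * (w1 s * w2 t)"
            using f by (intro mult_pos_pos[OF _ pos(1)]) linarith
          ultimately show ?thesis by linarith
        next
          case False
          have "(f2 s - f1 t) * (w2 s * w1 t) \<le> (f2 s - f1 t) * (w1 s * w2 t)"
            using False by (intro mult_left_mono w_mono[OF s t(2)]) simp
          also have "\<dots> < (f1 s - f2 t) * (w1 s * w2 t)"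
            using f by (intro mult_strict_right_mono[OF _ pos(1)]) linarith
          finally show ?thesis by linarith
        qed
      qed
      ultimately show "\<exists>l. (K has_real_derivative l) (at s) \<and> l < 0" by blast
    qed
    then show ?thesis by (simp add: K_def zero algebra_simps)
  qed
  have "H b < H a"
  proof (rule DERIV_neg_imp_decreasing_open[OF ab])
    show "continuous_on {a..b} H" unfolding H_def by (intro continuous_intros cont)
    fix t assume t: "a < t" "t < b"
    have "(H has_real_derivative
        f2 t * w2 t * B1 t + A2 t * w1 t - (f1 t * w1 t * B2 t + A1 t * w2 t)) (at t)"
      unfolding H_def
      by (rule derivative_eq_intros der[OF t] refl)+ (simp add: algebra_simps)
    then show "\<exists>l. (H has_real_derivative l) (at t) \<and> l < 0" using H_neg[OF t] by blast
  qed
  then show ?thesis by (simp add: H_def zero)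
qed

section \<open>The quotient under the logarithm and its monotonicity in \<open>a\<close> and
  \<open>x\<close>\<close>

definition ratio :: "real \<Rightarrow> real \<Rightarrow> real \<Rightarrow> real" where
  "ratio \<kappa> x a =
     ((x powr (a + 1) - 1) powr \<kappa> - (x powr a - 1) powr \<kappa>) /
     ((x powr (a + 1) - x) powr \<kappa> - (x powr a - x) powr \<kappa>)"

lemma F_eq_ln_ratio: "F \<kappa> x a = ln (ratio \<kappa> x a) / (\<kappa> * ln x)"
  by (simp add: F_def ratio_def)

lemma powr_bounds:
  fixes x a :: real
  assumes "1 < x" "1 \<le> a"
  shows "x \<le> x powr a" "x powr a < x powr (a + 1)"
  using powr_mono[of 1 a x] powr_less_mono[of a "a + 1" x] assms by auto

lemma ratio_num_pos:
  fixes x a \<kappa> :: real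
  assumes "0 < \<kappa>" "1 < x" "1 \<le> a"
  shows "0 < (x powr (a + 1) - 1) powr \<kappa> - (x powr a - 1) powr \<kappa>"
  using powr_bounds[of x a] assms by (intro powr_diff_pos) auto

lemma ratio_den_pos:
  fixes x a \<kappa> :: real
  assumes "0 < \<kappa>" "1 < x" "1 \<le> a"
  shows "0 < (x powr (a + 1) - x) powr \<kappa> - (x powr a - x) powr \<kappa>"
  using powr_bounds[of x a] assms by (intro powr_diff_pos) auto

lemma ratio_pos: "0 < ratio \<kappa> x a" if "0 < \<kappa>" "1 < x" "1 \<le> a"
  unfolding ratio_def using ratio_num_pos ratio_den_pos that by (intro divide_pos_pos) auto

text \<open>At the Cauchy point \<xi> the quotient equals
  \<open>((\<xi> - 1) / (\<xi> - x)) powr (\<kappa> - 1)\<close>, whose base exceeds 1.\<close>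

lemma ratio_gt_1:
  assumes "1 < \<kappa>" "1 < x" "1 \<le> a"
  shows "1 < ratio \<kappa> x a"
proof -
  let ?N = "(x powr (a + 1) - 1) powr \<kappa> - (x powr a - 1) powr \<kappa>"
  let ?D = "(x powr (a + 1) - x) powr \<kappa> - (x powr a - x) powr \<kappa>"
  note b = powr_bounds[OF assms(2,3)]
  obtain \<xi> where \<xi>: "x powr a < \<xi>"
    and eq: "?N * (\<xi> - x) powr (\<kappa> - 1) = ?D * (\<xi> - 1) powr (\<kappa> - 1)"
    using powr_shift_Cauchy_mvt[of \<kappa> "x powr a" "x powr (a + 1)" 1 x] b assms by auto
  have pos: "0 < ?D" using ratio_den_pos[of \<kappa> x a] assms by simp
  have "?D * (\<xi> - x) powr (\<kappa> - 1) < ?D * (\<xi> - 1) powr (\<kappa> - 1)"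
    using \<xi> b assms pos by (intro mult_strict_left_mono powr_less_mono2) auto
  then have "?D < ?N" unfolding eq[symmetric] using \<xi> b by (simp add: mult_less_cancel_right)
  then show ?thesis unfolding ratio_def using pos by simp
qed

text \<open>After this rescaling \<open>a\<close> enters only through the shift \<open>u\<close>:
  monotonicity in \<open>a\<close> becomes a comparison of shifts, and
  \<open>a \<rightarrow> \<infinity>\<close> becomes \<open>u \<rightarrow> 0\<close>. Pulling
  \<open>x powr \<kappa>\<close> out of the denominator makes both differences increments of the
  same function, over the adjacent intervals \<open>[1, x]\<close> and
  \<open>[1 / x, 1]\<close>.\<close>

lemma ratio_scaled:
  fixes x a :: real
  assumes "1 < x"
  defines "u \<equiv> x powr (- a)"
  shows "ratio \<kappa> x a =
    ((x - u) powr \<kappa> - (1 - u) powr \<kappa>) / (x powr \<kappa> * ((1 - u) powr \<kappa> - (1 / x - u) powr \<kappa>))"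
proof -
  let ?y = "x powr a"
  have u: "?y * u = 1" using assms by (simp add: powr_minus u_def)
  have eqs: "x powr (a + 1) - 1 = ?y * (x - u)" "?y - 1 = ?y * (1 - u)"
    "x powr (a + 1) - x = ?y * (x * (1 - u))" "?y - x = ?y * (x * (1 / x - u))"
    using u assms by (simp_all add: powr_add algebra_simps)
  have "0 < ?y powr \<kappa>" using assms by simp
  then show ?thesis unfolding ratio_def eqs powr_mult
    by (simp add: right_diff_distrib[symmetric])
qed

lemma ratio_strict_antimono_in_a:
  assumes "1 < \<kappa>" "1 < x" "1 \<le> a" "a < b"
  shows "ratio \<kappa> x b < ratio \<kappa> x a"
proof -
  define u v where "u = x powr (- b)" and "v = x powr (- a)"
  define N D where "N w = (x - w) powr \<kappa> - (1 - w) powr \<kappa>"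
    and "D w = (1 - w) powr \<kappa> - (1 / x - w) powr \<kappa>" for w
  have uv: "0 < u" "v \<le> 1 / x" "1 / x < 1"
    unfolding u_def v_def
    using assms powr_mono[of "- a" "- 1" x] by (simp_all add: powr_minus_divide)
  have "u < v" unfolding u_def v_def using assms by (intro powr_less_mono) auto
  note uv = uv this
  \<comment> \<open>The Cauchy points satisfy \<open>\<eta> < 1 < \<xi>\<close>. Since
    \<open>u < v\<close>, the quotient \<open>(t - u) / (t - v)\<close> decreases in
    \<open>t > v\<close>, so \<open>N u / N v < D u / D v\<close>. The products \<open>?r\<close>
    and \<open>?p\<close> below express this without division.\<close>
  obtain \<xi> where \<xi>: "1 < \<xi>"
    and eqN: "N u * (\<xi> - v) powr (\<kappa> - 1) = N v * (\<xi> - u) powr (\<kappa> - 1)"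
    unfolding N_def using powr_shift_Cauchy_mvt[of \<kappa> 1 x u v] uv assms by auto
  obtain \<eta> where \<eta>: "1 / x < \<eta>" "\<eta> < 1"
    and eqD: "D u * (\<eta> - v) powr (\<kappa> - 1) = D v * (\<eta> - u) powr (\<kappa> - 1)"
    unfolding D_def using powr_shift_Cauchy_mvt[of \<kappa> "1 / x" 1 u v] uv assms by auto
  have D: "0 < D u" "0 < D v"
    unfolding D_def by (intro powr_diff_pos; use uv assms in linarith)+
  have N: "0 < N u" "0 < N v"
    unfolding N_def by (intro powr_diff_pos; use uv assms in linarith)+
  let ?p = "(\<xi> - v) * (\<eta> - u)" and ?r = "(\<xi> - u) * (\<eta> - v)"
  have "?p - ?r = (\<xi> - \<eta>) * (v - u)" by algebra
  moreover have "0 < (\<xi> - \<eta>) * (v - u)" using uv \<xi> \<eta> by (intro mult_pos_pos) auto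
  moreover have "0 < ?r" using uv \<xi> \<eta> by (intro mult_pos_pos) auto
  ultimately have pr: "0 < ?r" "?r < ?p" by linarith+
  have "(N u * D v) * ?p powr (\<kappa> - 1) =
      (N u * (\<xi> - v) powr (\<kappa> - 1)) * (D v * (\<eta> - u) powr (\<kappa> - 1))"
    by (simp add: powr_mult)
  also have "\<dots> = (N v * D u) * ?r powr (\<kappa> - 1)"
    unfolding eqN eqD[symmetric] by (simp add: powr_mult)
  also have "\<dots> < (N v * D u) * ?p powr (\<kappa> - 1)"
    using N D pr assms by (intro mult_strict_left_mono powr_less_mono2) auto
  finally have "N u * D v < N v * D u" using pr by (simp add: mult_less_cancel_right)
  moreover have rat: "ratio \<kappa> x b = N u / (x powr \<kappa> * D u)" "ratio \<kappa> x a = N v / (x powr \<kappa> * D v)"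
    using ratio_scaled[of x \<kappa>] assms by (simp_all add: N_def D_def u_def v_def)
  ultimately show ?thesis unfolding rat using D assms by (simp add: divide_simps mult_ac)
qed

lemma ratio_strict_antimono_in_x:
  assumes \<kappa>: "1 < \<kappa>" and xz: "1 < x" "x < z" and a: "1 \<le> a"
  shows "ratio \<kappa> z a < ratio \<kappa> x a"
proof -
  define A where "A y t = (y powr t - 1) powr \<kappa> - (y powr a - 1) powr \<kappa>" for y t
  define B where "B y t = (y powr t - y) powr \<kappa> - (y powr a - y) powr \<kappa>" for y t
  define f where "f y t = ((y powr t - 1) / (y powr t - y)) powr (\<kappa> - 1)" for y t
  define w where "w y t = \<kappa> * ln y * ((y powr t - y) powr (\<kappa> - 1) * y powr t)" for y t
  have gt: "y < y powr t" if "1 < y" "a < t" for y t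
    using powr_less_mono[of 1 t y] that a by simp
  have ge: "y \<le> y powr t" if "1 < y" "a \<le> t" for y t
    using powr_mono[of 1 t y] that a by simp
  have contA: "continuous_on {a..a + 1} (A y)" and contB: "continuous_on {a..a + 1} (B y)"
    if "1 < y" for y
  proof -
    have "0 \<le> y powr t - 1" "0 \<le> y powr t - y" if "a \<le> t" for t
      using ge[of y t] that \<open>1 < y\<close> by linarith+
    then show "continuous_on {a..a + 1} (A y)" "continuous_on {a..a + 1} (B y)"
      unfolding A_def B_def using that \<kappa>
      by (intro continuous_on_diff continuous_on_const continuous_on_powr' continuous_intros; simp)+
  qed
  have derB: "(B y has_real_derivative w y t) (at t)" if "1 < y" "a < t" for y t
    unfolding B_def w_def using that gt[OF that]
    by (auto intro!: derivative_eq_intros simp: algebra_simps)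
  have derA: "(A y has_real_derivative f y t * w y t) (at t)" if "1 < y" "a < t" for y t
  proof -
    have "f y t * (y powr t - y) powr (\<kappa> - 1) = (y powr t - 1) powr (\<kappa> - 1)"
      unfolding f_def powr_mult[symmetric] using gt[OF that] by simp
    then have "f y t * w y t = \<kappa> * ln y * ((y powr t - 1) powr (\<kappa> - 1) * y powr t)"
      unfolding w_def by (simp add: mult_ac)
    then show ?thesis unfolding A_def using that gt[OF that]
      by (auto intro!: derivative_eq_intros simp: algebra_simps)
  qed
  \<comment> \<open>In this form both monotonicity claims about \<open>f\<close> reduce to the
    quotient \<open>(y - 1) / (y powr t - y)\<close>.\<close>
  have f_alt: "(y powr t - 1) / (y powr t - y) = 1 + (y - 1) / (y powr t - y)"
    if "1 < y" "a < t" for y t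
    using gt[OF that] by (simp add: field_simps)
  have "A z (a + 1) * B x (a + 1) < A x (a + 1) * B z (a + 1)"
  proof (rule quotient_less_if_deriv_quotients[where a = a and b = "a + 1" and ?A1.0 = "A x" and
        ?A2.0 = "A z" and ?B1.0 = "B x" and ?B2.0 = "B z" and ?f1.0 = "f x" and ?f2.0 = "f z"
        and ?w1.0 = "w x" and ?w2.0 = "w z"])
    show "0 < w x t" "0 < w z t" if "a < t" for t
      using gt[of x t] gt[of z t] that xz \<kappa> by (auto simp: w_def)
    show "f z t < f x t" if "a < t" for t
    proof -
      \<comment> \<open>The slope of the \<open>t\<close>-th power from 1 increases with the
        endpoint; subtracting 1 from both slopes replaces \<open>y powr t - 1\<close> by
        \<open>y powr t - y\<close>.\<close>
      have "(x powr t - 1) * (z - 1) < (z powr t - 1) * (x - 1)"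
        using xz that a by (intro powr_slope_at_1_less_above) auto
      then have "(z - 1) * (x powr t - x) < (x - 1) * (z powr t - z)"
        by (simp add: algebra_simps)
      then have "(z - 1) / (z powr t - z) < (x - 1) / (x powr t - x)"
        using gt[of x t] gt[of z t] xz that by (simp add: divide_simps)
      moreover have "0 < (z - 1) / (z powr t - z)" using gt[of z t] xz that by simp
      ultimately show ?thesis unfolding f_def using \<kappa> xz that
        by (simp add: f_alt powr_less_mono2)
    qed
    show "f x t \<le> f x s" if "a < s" "s < t" for s t
    proof -
      have "x powr s < x powr t" using xz that by (intro powr_less_mono) auto
      then have "(x - 1) / (x powr t - x) \<le> (x - 1) / (x powr s - x)"
        using gt[of x s] gt[of x t] xz that by (intro divide_left_mono) auto
      moreover have "0 < (x - 1) / (x powr t - x)" using gt[of x t] xz that by simp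
      ultimately show ?thesis unfolding f_def using \<kappa> xz that
        by (simp add: f_alt powr_mono2)
    qed
    show "w z s * w x t \<le> w x s * w z t" if st: "a < s" "s < t" for s t
    proof -
      \<comment> \<open>As \<open>s > a \<ge> 1\<close>, \<open>s - 1\<close> is positive. With
        \<open>X = x powr (s - 1)\<close>, the quotient
        \<open>(x powr t - x) / (x powr s - x)\<close> becomes
        \<open>(X powr r - 1) / (X - 1)\<close>, again a slope from 1 and thus increasing in the
        base.\<close>
      define r X Z where "r = (t - 1) / (s - 1)" and "X = x powr (s - 1)" and "Z = z powr (s - 1)"
      have r: "(s - 1) * r = t - 1" using st a by (simp add: r_def)
      have fac: "y powr s - y = y * (y powr (s - 1) - 1)"
        "y powr t - y = y * ((y powr (s - 1)) powr r - 1)" if "1 < y" for y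
        using that st a powr_add[of y 1 "s - 1"] powr_add[of y 1 "t - 1"]
        by (simp_all add: powr_powr r right_diff_distrib)
      have XZ: "1 < X" "X < Z" "1 < r"
        using st xz a powr_less_mono[of 0 "s - 1" x]
        by (auto simp: X_def Z_def r_def intro!: powr_less_mono2)
      have "(X powr r - 1) * (Z - 1) \<le> (Z powr r - 1) * (X - 1)"
        using powr_slope_at_1_less_above[of r X Z] XZ by simp
      then have "x * z * ((X powr r - 1) * (Z - 1)) \<le> x * z * ((Z powr r - 1) * (X - 1))"
        using xz by (intro mult_left_mono) auto
      then have le: "(z powr s - z) * (x powr t - x) \<le> (x powr s - x) * (z powr t - z)"
        using xz by (simp add: fac X_def Z_def mult_ac)
      \<comment> \<open>The remaining factor of the weight quotient is
        \<open>y powr (t - s)\<close>, which grows with \<open>y\<close>.\<close>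
      have "(z / x) powr s \<le> (z / x) powr t" using xz st by (intro powr_mono) auto
      then have le': "z powr s * x powr t \<le> x powr s * z powr t"
        using xz by (simp add: powr_divide divide_simps mult_ac)
      have "0 \<le> (z powr s - z) * (x powr t - x)"
        using gt[of z s] gt[of x t] xz st by (intro mult_nonneg_nonneg) auto
      then have "((z powr s - z) * (x powr t - x)) powr (\<kappa> - 1) * (z powr s * x powr t) \<le>
          ((x powr s - x) * (z powr t - z)) powr (\<kappa> - 1) * (x powr s * z powr t)"
        using \<kappa> le by (intro mult_mono[OF powr_mono2 le']) auto
      then have "(\<kappa> * ln x) * (\<kappa> * ln z) *
          (((z powr s - z) * (x powr t - x)) powr (\<kappa> - 1) * (z powr s * x powr t)) \<le>
        (\<kappa> * ln x) * (\<kappa> * ln z) *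
          (((x powr s - x) * (z powr t - z)) powr (\<kappa> - 1) * (x powr s * z powr t))"
        using \<kappa> xz by (intro mult_left_mono) auto
      then show ?thesis by (simp only: w_def powr_mult mult_ac)
    qed
    show "continuous_on {a..a + 1} (A x)" "continuous_on {a..a + 1} (A z)"
      "continuous_on {a..a + 1} (B x)" "continuous_on {a..a + 1} (B z)"
      using contA contB xz by auto
    show "A x a = 0" "A z a = 0" "B x a = 0" "B z a = 0" by (simp_all add: A_def B_def)
  qed (use xz derA derB in auto)
  moreover have "0 < B x (a + 1)" "0 < B z (a + 1)"
    using ratio_den_pos[of \<kappa> x a] ratio_den_pos[of \<kappa> z a] xz \<kappa> a by (simp_all add: B_def)
  ultimately have "A z (a + 1) / B z (a + 1) < A x (a + 1) / B x (a + 1)"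
    by (simp add: divide_simps)
  then show ?thesis by (simp add: ratio_def A_def B_def)
qed

section \<open>Dependence on \<kappa>\<close>

lemma F_factored:
  fixes x a \<kappa> :: real
  assumes "1 < x" "1 \<le> a" "0 < \<kappa>"
  defines "P \<equiv> x powr (a + 1) - 1" and "Q \<equiv> x powr a - 1"
    and "R \<equiv> x powr (a + 1) - x" and "S \<equiv> x powr a - x"
  shows "F \<kappa> x a =
    (ln (P / R) - (ln (1 - (S / R) powr \<kappa>) - ln (1 - (Q / P) powr \<kappa>)) / \<kappa>) / ln x"
    "0 \<le> S / R" "S / R < Q / P" "Q / P < 1"
proof -
  note b = powr_bounds[OF assms(1,2)]
  have pos: "0 < P" "0 < Q" "0 < R" "0 \<le> S" "Q < P" "S < R"
    unfolding P_def Q_def R_def S_def using b assms(1) by linarith+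
  then show "0 \<le> S / R" "Q / P < 1" by auto
  \<comment> \<open>This factorisation gives the order \<open>S / R < Q / P\<close>, on which the
    monotonicity in \<kappa> rests. For \<open>a = 1\<close> the base \<open>S / R\<close> is
    0.\<close>
  have "Q * R - S * P = (x - 1) * (x powr (a + 1) - x powr a)"
    unfolding P_def Q_def R_def S_def by algebra
  moreover have "0 < (x - 1) * (x powr (a + 1) - x powr a)"
    using b assms(1) by (intro mult_pos_pos) linarith+
  ultimately have "S * P < Q * R" by linarith
  then show "S / R < Q / P" using pos by (simp add: divide_simps)
  have lt1: "(Q / P) powr \<kappa> < 1" "(S / R) powr \<kappa> < 1"
    using pos assms powr_less_mono2[of \<kappa> "Q / P" 1] powr_less_mono2[of \<kappa> "S / R" 1] by auto
  have N: "P powr \<kappa> - Q powr \<kappa> = P powr \<kappa> * (1 - (Q / P) powr \<kappa>)"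
    "R powr \<kappa> - S powr \<kappa> = R powr \<kappa> * (1 - (S / R) powr \<kappa>)"
    using pos by (simp_all add: powr_divide right_diff_distrib)
  have "ratio \<kappa> x a = (P powr \<kappa> * (1 - (Q / P) powr \<kappa>)) / (R powr \<kappa> * (1 - (S / R) powr \<kappa>))"
    unfolding N[symmetric] by (simp add: ratio_def P_def Q_def R_def S_def)
  then have "ln (ratio \<kappa> x a) = ln (P powr \<kappa>) + ln (1 - (Q / P) powr \<kappa>) -
      (ln (R powr \<kappa>) + ln (1 - (S / R) powr \<kappa>))"
    using pos lt1 by (simp add: ln_div ln_mult)
  then have "ln (ratio \<kappa> x a) =
      \<kappa> * ln (P / R) - (ln (1 - (S / R) powr \<kappa>) - ln (1 - (Q / P) powr \<kappa>))"
    using pos by (simp add: ln_div ln_powr right_diff_distrib)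
  then show "F \<kappa> x a =
    (ln (P / R) - (ln (1 - (S / R) powr \<kappa>) - ln (1 - (Q / P) powr \<kappa>)) / \<kappa>) / ln x"
    unfolding F_eq_ln_ratio using assms(1,3) by (simp add: divide_simps)
qed

text \<open>Substituting \<open>y = t powr \<kappa>\<close> turns
  \<open>(1 - t powr l) / (1 - t powr \<kappa>)\<close> into the slope of
  \<open>y powr (l / \<kappa>)\<close> between \<open>y\<close> and 1. The exponent exceeds 1, so
  the slope is larger at \<open>q\<close> than at \<open>s\<close>.\<close>

lemma ln_one_minus_powr_diff_antimono:
  fixes s q \<kappa> l :: real
  assumes "0 < \<kappa>" "\<kappa> < l" "0 \<le> s" "s < q" "q < 1"
  shows "ln (1 - s powr l) - ln (1 - q powr l) < ln (1 - s powr \<kappa>) - ln (1 - q powr \<kappa>)"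
proof -
  have lt1: "t powr m < 1" if "0 \<le> t" "t < 1" "0 < m" for t m :: real
    using powr_less_mono2[of m t 1] that by simp
  have "(1 - (s powr \<kappa>) powr (l / \<kappa>)) * (1 - q powr \<kappa>) <
      (1 - (q powr \<kappa>) powr (l / \<kappa>)) * (1 - s powr \<kappa>)"
    using assms lt1 by (intro powr_slope_at_1_less_below powr_less_mono2) auto
  then have "(1 - s powr l) * (1 - q powr \<kappa>) < (1 - q powr l) * (1 - s powr \<kappa>)"
    using assms by (simp add: powr_powr)
  moreover have pos: "0 < 1 - s powr l" "0 < 1 - q powr \<kappa>" "0 < 1 - q powr l" "0 < 1 - s powr \<kappa>"
    using assms lt1 by auto
  ultimately have "ln ((1 - s powr l) * (1 - q powr \<kappa>)) < ln ((1 - q powr l) * (1 - s powr \<kappa>))"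
    by (subst ln_less_cancel_iff) auto
  then show ?thesis using pos by (simp add: ln_mult)
qed

lemma F_strict_mono_in_kappa:
  assumes "0 < \<kappa>" "\<kappa> < l" "1 < x" "1 \<le> a"
  shows "F \<kappa> x a < F l x a"
proof -
  define P Q R S where "P = x powr (a + 1) - 1" and "Q = x powr a - 1"
    and "R = x powr (a + 1) - x" and "S = x powr a - x"
  define E where "E m = ln (1 - (S / R) powr m) - ln (1 - (Q / P) powr m)" for m
  note fac = F_factored[OF assms(3,4), folded P_def Q_def R_def S_def]
  have sq: "0 \<le> S / R" "S / R < Q / P" "Q / P < 1" using fac(2-4)[OF assms(1)] by auto
  have F: "F m x a = (ln (P / R) - E m / m) / ln x" if "0 < m" for m
    using fac(1)[OF that] by (simp add: E_def)
  have "(S / R) powr l < (Q / P) powr l" "(Q / P) powr l < 1"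
    using sq assms powr_less_mono2[of l "Q / P" 1] by (auto intro!: powr_less_mono2)
  then have E_pos: "0 < E l" by (simp add: E_def)
  have "E l < E \<kappa>"
    unfolding E_def using sq assms by (intro ln_one_minus_powr_diff_antimono) auto
  \<comment> \<open>Positivity of \<open>E l\<close> matters here: a positive numerator shrinks
    while the denominator grows.\<close>
  then have "E l / l < E \<kappa> / \<kappa>"
    using E_pos assms by (intro frac_less) auto
  then show ?thesis using assms by (simp add: F divide_strict_right_mono)
qed

section \<open>Monotonicity in \<open>x\<close> and \<open>a\<close>, and continuity\<close>

lemma F_strict_antimono_in_x:
  assumes "1 < \<kappa>" "1 < x" "x < z" "1 \<le> a"
  shows "F \<kappa> z a < F \<kappa> x a"
proof -
  \<comment> \<open>The bound 1 makes the logarithms positive, so the growing factor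
    \<open>ln x\<close> in the denominator also lowers the value.\<close>
  have r: "1 < ratio \<kappa> z a" "ratio \<kappa> z a < ratio \<kappa> x a"
    using assms by (auto intro: ratio_gt_1 ratio_strict_antimono_in_x)
  then have "ln (ratio \<kappa> z a) < ln (ratio \<kappa> x a)" "0 < ln (ratio \<kappa> z a)" by auto
  then show ?thesis
    unfolding F_eq_ln_ratio using assms by (intro frac_less) auto
qed

lemma F_strict_antimono_in_a:
  assumes "1 < \<kappa>" "1 < x" "1 \<le> a" "a < b"
  shows "F \<kappa> x b < F \<kappa> x a"
proof -
  have "1 < ratio \<kappa> x b" "ratio \<kappa> x b < ratio \<kappa> x a"
    using assms by (auto intro: ratio_gt_1 ratio_strict_antimono_in_a)
  then have "ln (ratio \<kappa> x b) < ln (ratio \<kappa> x a)" by auto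
  then show ?thesis
    unfolding F_eq_ln_ratio using assms by (intro divide_strict_right_mono) auto
qed

text \<open>Letting all three parameters vary serves the continuity claims in each variable at once.
  Admitting \<open>0 < k t\<close> makes \<kappa> = 1 an interior point, from which the limit at 1
  is read off.\<close>

lemma continuous_on_F:
  fixes k x a :: "'t::topological_space \<Rightarrow> real"
  assumes "continuous_on T k" "continuous_on T x" "continuous_on T a"
    and pos: "\<And>t. t \<in> T \<Longrightarrow> 0 < k t" "\<And>t. t \<in> T \<Longrightarrow> 1 < x t" "\<And>t. t \<in> T \<Longrightarrow> 1 \<le> a t"
  shows "continuous_on T (\<lambda>t. F (k t) (x t) (a t))"
proof -
  have b: "x t \<le> x t powr a t" "x t powr a t < x t powr (a t + 1)" if "t \<in> T" for t
    using powr_bounds[OF pos(2)[OF that] pos(3)[OF that]] by auto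
  have base: "0 \<le> x t powr (a t + 1) - 1" "0 \<le> x t powr a t - 1"
    "0 \<le> x t powr (a t + 1) - x t" "0 \<le> x t powr a t - x t" if "t \<in> T" for t
    using b[OF that] pos(2)[OF that] by linarith+
  have x0: "\<forall>t\<in>T. x t \<noteq> 0" "\<forall>t\<in>T. k t * ln (x t) \<noteq> 0" using pos(1,2) by force+
  have p: "continuous_on T (\<lambda>t. x t powr a t)" "continuous_on T (\<lambda>t. x t powr (a t + 1))"
    by (intro continuous_on_powr assms(1-3) continuous_on_add continuous_on_const x0(1))+
  have q: "continuous_on T (\<lambda>t. f t powr k t)"
    if "continuous_on T f" "\<And>t. t \<in> T \<Longrightarrow> 0 \<le> f t" for f :: "'t \<Rightarrow> real"
    using that pos(1) by (intro continuous_on_powr' assms(1)) auto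
  have den: "\<forall>t\<in>T. (x t powr (a t + 1) - x t) powr k t - (x t powr a t - x t) powr k t \<noteq> 0"
    using ratio_den_pos[OF pos] by (intro ballI less_imp_neq[THEN not_sym]) blast
  have "continuous_on T (\<lambda>t. ratio (k t) (x t) (a t))"
    unfolding ratio_def
    by (intro continuous_on_divide continuous_on_diff q p base assms(2) continuous_on_const den)
  moreover have "\<forall>t\<in>T. ratio (k t) (x t) (a t) \<noteq> 0"
    using ratio_pos[OF pos] by (intro ballI less_imp_neq[THEN not_sym]) blast
  ultimately show ?thesis
    unfolding F_eq_ln_ratio
    by (intro continuous_on_divide continuous_on_ln continuous_on_mult assms(1,2) x0)
qed

section \<open>Limits\<close>

lemma F_tendsto_x_at_top:
  assumes "1 < \<kappa>" "1 \<le> a"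
  shows "((\<lambda>x. F \<kappa> x a) \<longlongrightarrow> 0) at_top"
proof (rule tendsto_sandwich[OF _ _ tendsto_const])
  show "((\<lambda>x. ln (ratio \<kappa> 2 a) / (\<kappa> * ln x)) \<longlongrightarrow> 0) at_top"
    using assms
    by (intro tendsto_divide_0[OF tendsto_const] filterlim_at_top_imp_at_infinity
        filterlim_tendsto_pos_mult_at_top[OF tendsto_const] ln_at_top) auto
  \<comment> \<open>The point 2 is an arbitrary reference: beyond it the quotient stays between 1
    and its value at 2.\<close>
  have "0 \<le> F \<kappa> x a \<and> F \<kappa> x a \<le> ln (ratio \<kappa> 2 a) / (\<kappa> * ln x)" if "2 < x" for x
  proof -
    have "1 < ratio \<kappa> x a" "ratio \<kappa> x a < ratio \<kappa> 2 a"
      using assms that by (auto intro: ratio_gt_1 ratio_strict_antimono_in_x)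
    then show ?thesis
      unfolding F_eq_ln_ratio using assms that by (auto intro!: divide_right_mono)
  qed
  then show "\<forall>\<^sub>F x in at_top. 0 \<le> F \<kappa> x a"
    "\<forall>\<^sub>F x in at_top. F \<kappa> x a \<le> ln (ratio \<kappa> 2 a) / (\<kappa> * ln x)"
    by (auto intro: eventually_mono[OF eventually_gt_at_top[of 2]])
qed

lemma F_tendsto_x_at_right_1:
  assumes "1 < \<kappa>" "1 \<le> a"
  shows "filterlim (\<lambda>x. F \<kappa> x a) at_top (at_right 1)"
proof (rule filterlim_at_top_mono)
  have ev: "\<forall>\<^sub>F x in at_right 1. 1 < x \<and> x < (2::real)"
    using eventually_at_right_real[of 1 "2::real"] by simp
  show "filterlim (\<lambda>x. ln (ratio \<kappa> 2 a) / (\<kappa> * ln x)) at_top (at_right 1)"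
  proof (rule LIM_at_top_divide[OF tendsto_const])
    show "0 < ln (ratio \<kappa> 2 a)" using ratio_gt_1[of \<kappa> 2 a] assms by simp
    have "((\<lambda>x. \<kappa> * ln x) \<longlongrightarrow> \<kappa> * ln 1) (at_right (1::real))" by (intro tendsto_intros) auto
    then show "((\<lambda>x. \<kappa> * ln x) \<longlongrightarrow> 0) (at_right (1::real))" by simp
    show "\<forall>\<^sub>F x in at_right 1. 0 < \<kappa> * ln x"
      using ev by eventually_elim (use assms in simp)
  qed
  \<comment> \<open>To the left of 2 the quotient exceeds its value at 2, whose logarithm is a
    positive constant.\<close>
  show "\<forall>\<^sub>F x in at_right 1. ln (ratio \<kappa> 2 a) / (\<kappa> * ln x) \<le> F \<kappa> x a"
    using ev
  proof eventually_elim
    case (elim x)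
    have "1 < ratio \<kappa> 2 a" "ratio \<kappa> 2 a < ratio \<kappa> x a"
      using assms elim by (auto intro: ratio_gt_1 ratio_strict_antimono_in_x)
    then show ?case
      unfolding F_eq_ln_ratio using assms elim by (auto intro!: divide_right_mono)
  qed
qed

lemma powr_tendsto_0_at_top:
  fixes t :: real
  assumes "0 \<le> t" "t < 1"
  shows "((\<lambda>m. t powr m) \<longlongrightarrow> 0) at_top"
proof (cases "t = 0")
  case False
  then have "((\<lambda>m. exp (ln t * m)) \<longlongrightarrow> 0) at_top"
    using assms
    by (intro filterlim_compose[OF exp_at_bot]
        filterlim_tendsto_neg_mult_at_bot[OF tendsto_const] filterlim_ident) auto
  then show ?thesis using False by (simp add: powr_def mult.commute)
qed simp

lemma F_tendsto_a_at_top: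
  assumes "1 < \<kappa>" "1 < x"
  shows "((\<lambda>a. F \<kappa> x a) \<longlongrightarrow> 0) at_top"
proof -
  have u: "((\<lambda>a. x powr (- a)) \<longlongrightarrow> 0) at_top"
    using powr_tendsto_0_at_top[of "1 / x"] assms by (simp add: powr_divide powr_minus_divide)
  have gt: "1 < x powr \<kappa>" using assms powr_less_mono[of 0 \<kappa> x] by simp
  have "((\<lambda>a. ratio \<kappa> x a) \<longlongrightarrow>
      ((x - 0) powr \<kappa> - (1 - 0) powr \<kappa>) / (x powr \<kappa> * ((1 - 0) powr \<kappa> - (1 / x - 0) powr \<kappa>))) at_top"
    unfolding ratio_scaled[OF assms(2)] using assms gt
    by (intro tendsto_intros u) (auto simp: powr_divide)
  \<comment> \<open>At \<open>u = 0\<close> numerator and denominator are both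
    \<open>x powr \<kappa> - 1\<close>.\<close>
  moreover have "((x - 0) powr \<kappa> - (1 - 0) powr \<kappa>) /
      (x powr \<kappa> * ((1 - 0) powr \<kappa> - (1 / x - 0) powr \<kappa>)) = 1"
    using gt assms by (simp add: powr_divide right_diff_distrib)
  ultimately have "((\<lambda>a. ratio \<kappa> x a) \<longlongrightarrow> 1) at_top" by (simp only:)
  then have "((\<lambda>a. ln (ratio \<kappa> x a) / (\<kappa> * ln x)) \<longlongrightarrow> ln 1 / (\<kappa> * ln x)) at_top"
    using assms by (intro tendsto_intros) auto
  then show ?thesis by (simp add: F_eq_ln_ratio)
qed

lemma F_tendsto_kappa_at_top:
  assumes "1 < x" "1 \<le> a"
  shows "((\<lambda>\<kappa>. F \<kappa> x a) \<longlongrightarrow>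
    1 / ln x * ln ((x powr (a + 1) - 1) / (x powr (a + 1) - x))) at_top"
proof -
  define P Q R S where "P = x powr (a + 1) - 1" and "Q = x powr a - 1"
    and "R = x powr (a + 1) - x" and "S = x powr a - x"
  note fac = F_factored[OF assms, folded P_def Q_def R_def S_def]
  have sq: "0 \<le> S / R" "S / R < Q / P" "Q / P < 1" using fac(2-4)[of 1] by auto
  \<comment> \<open>Both bases lie in \<open>[0, 1)\<close>, so their powers vanish in the limit and
    only \<open>ln (P / R)\<close> survives.\<close>
  have "((\<lambda>\<kappa>. ln (1 - (S / R) powr \<kappa>) - ln (1 - (Q / P) powr \<kappa>)) \<longlongrightarrow> ln (1 - 0) - ln (1 - 0)) at_top"
    using sq by (intro tendsto_intros powr_tendsto_0_at_top) auto
  then have "((\<lambda>\<kappa>. (ln (1 - (S / R) powr \<kappa>) - ln (1 - (Q / P) powr \<kappa>)) / \<kappa>) \<longlongrightarrow> 0) at_top"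
    by (rule tendsto_divide_0) (simp add: filterlim_at_top_imp_at_infinity filterlim_ident)
  then have "((\<lambda>\<kappa>. (ln (P / R) - (ln (1 - (S / R) powr \<kappa>) - ln (1 - (Q / P) powr \<kappa>)) / \<kappa>) / ln x)
      \<longlongrightarrow> (ln (P / R) - 0) / ln x) at_top"
    using assms by (intro tendsto_intros) auto
  then have "((\<lambda>\<kappa>. F \<kappa> x a) \<longlongrightarrow> (ln (P / R) - 0) / ln x) at_top"
    by (rule Lim_transform_eventually)
      (use fac(1) in \<open>auto intro: eventually_mono[OF eventually_gt_at_top[of 0]]\<close>)
  then show ?thesis by (simp add: P_def R_def)
qed

lemma F_tendsto_kappa_at_right_1:
  assumes "1 < x" "1 \<le> a"
  shows "((\<lambda>\<kappa>. F \<kappa> x a) \<longlongrightarrow> 0) (at_right 1)"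
proof -
  have "continuous_on {0<..} (\<lambda>\<kappa>. F \<kappa> x a)"
    using assms by (intro continuous_on_F continuous_on_id continuous_on_const) auto
  then have "isCont (\<lambda>\<kappa>. F \<kappa> x a) 1"
    by (simp add: continuous_on_eq_continuous_at)
  then have "((\<lambda>\<kappa>. F \<kappa> x a) \<longlongrightarrow> F 1 x a) (at_right 1)"
    unfolding isCont_def by (rule filterlim_mono) (auto simp: at_le)
  \<comment> \<open>For \<kappa> = 1 the subtracted constants cancel, leaving
    \<open>x powr (a + 1) - x powr a\<close> in both numerator and denominator.\<close>
  moreover have "ratio 1 x a = 1"
  proof -
    have "0 \<le> x powr (a + 1) - 1" "0 \<le> x powr a - 1"
      "0 \<le> x powr (a + 1) - x" "0 \<le> x powr a - x" "x powr (a + 1) \<noteq> x powr a"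
      using powr_bounds[OF assms] assms(1) by linarith+
    then show ?thesis unfolding ratio_def by (simp add: abs_of_nonneg)
  qed
  ultimately show ?thesis by (simp add: F_eq_ln_ratio)
qed

theorem theorem4p3:
  shows
    "(\<forall>\<kappa>>1. \<forall>a\<ge>1. continuous_on {1<..} (\<lambda>x. F \<kappa> x a) \<and> strict_antimono_on {1<..} (\<lambda>x. F \<kappa> x a))
   \<and> (\<forall>\<kappa>>1. \<forall>x>1. continuous_on {1..} (\<lambda>a. F \<kappa> x a) \<and> strict_antimono_on {1..} (\<lambda>a. F \<kappa> x a))
   \<and> (\<forall>x>1. \<forall>a\<ge>1. continuous_on {1<..} (\<lambda>\<kappa>. F \<kappa> x a) \<and> strict_mono_on {1<..} (\<lambda>\<kappa>. F \<kappa> x a))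
   \<and> (\<forall>\<kappa>>1. \<forall>a\<ge>1. ((\<lambda>x. F \<kappa> x a) \<longlongrightarrow> 0) at_top)
   \<and> (\<forall>\<kappa>>1. \<forall>x>1. ((\<lambda>a. F \<kappa> x a) \<longlongrightarrow> 0) at_top)
   \<and> (\<forall>\<kappa>>1. \<forall>a\<ge>1. filterlim (\<lambda>x. F \<kappa> x a) at_top (at_right 1))
   \<and> (\<forall>x>1. \<forall>a\<ge>1. ((\<lambda>\<kappa>. F \<kappa> x a) \<longlongrightarrow>
         1 / ln x * ln ((x powr (a + 1) - 1) / (x powr (a + 1) - x))) at_top)
   \<and> (\<forall>x>1. \<forall>a\<ge>1. ((\<lambda>\<kappa>. F \<kappa> x a) \<longlongrightarrow> 0) (at_right 1))"
proof (intro conjI allI impI)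
  show "continuous_on {1<..} (\<lambda>x. F \<kappa> x a)" if "1 < \<kappa>" "1 \<le> a" for \<kappa> a
    using that by (intro continuous_on_F continuous_on_id continuous_on_const) auto
  show "continuous_on {1..} (\<lambda>a. F \<kappa> x a)" if "1 < \<kappa>" "1 < x" for \<kappa> x
    using that by (intro continuous_on_F continuous_on_id continuous_on_const) auto
  show "continuous_on {1<..} (\<lambda>\<kappa>. F \<kappa> x a)" if "1 < x" "1 \<le> a" for x a
    using that by (intro continuous_on_F continuous_on_id continuous_on_const) auto
  show "strict_antimono_on {1<..} (\<lambda>x. F \<kappa> x a)" if "1 < \<kappa>" "1 \<le> a" for \<kappa> a
    using that by (auto intro!: monotone_onI F_strict_antimono_in_x)
  show "strict_antimono_on {1..} (\<lambda>a. F \<kappa> x a)" if "1 < \<kappa>" "1 < x" for \<kappa> x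
    using that by (auto intro!: monotone_onI F_strict_antimono_in_a)
  show "strict_mono_on {1<..} (\<lambda>\<kappa>. F \<kappa> x a)" if "1 < x" "1 \<le> a" for x a
    using that by (auto intro!: monotone_onI F_strict_mono_in_kappa)
qed (erule (1) F_tendsto_x_at_top F_tendsto_a_at_top F_tendsto_x_at_right_1
    F_tendsto_kappa_at_top F_tendsto_kappa_at_right_1)+

end
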